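(* Let $k\ge2$ and $\lambda_i=1/k$ for all $i\in[k]$. Let $t\in[k]$ be a fixed constant and let $$S_2^t:=\Big\{\frac1t\sum_{i\in\mathcal{T}}\bm{x}_i:\ \mathcal{T}\subseteq[k],\ |\mathcal{T}|=t,\ \bm{x}_i\in\Xi_i\ \text{for } i\in\mathcal{T}\Big\}.$$ Then $$v(S_2^t)\le\Big(1+\frac{k-t}{t(k-1)}\Big)v^*,$$ and the support size satisfies $|S_2^t|=O((nk)^t)$.
   Context: Notation: $[k]=\{1,\dots,k\}$. For $i\in[k]$, $\mathbb{P}_i=\sum_{j\in[|\Xi_i|]}\hat p_{ij}\delta_{\hat{\bm{x}}_{ij}}$ is a probability measure supported on a nonempty finite set $\Xi_i=\{\hat{\bm{x}}_{ij}\}_j\subseteq\mathbb{R}^d$ with $|\Xi_i|\le n$. The barycenter value for weights $\lambda_1,\dots,\lambda_k\ge 0$ summing to $1$ is $v^*=\inf_{\mathbb{P}}\sum_{i\in[k]}\lambda_iW_2^2(\mathbb{P},\mathbb{P}_i)$, the infimum over Borel probability measures on $\mathbb{R}^d$ with finite second moment, where $W_2$ is the type-2 Wasserstein distance for the Euclidean norm. For a nonempty finite set $S\subseteq\mathbb{R}^d$ and $\vec{\bm{j}}=(j_1,\dots,j_k)$ with $j_i\in[|\Xi_i|]$, put $C_{\vec{\bm{j}}}(S)=\min_{\bm{w}\in S}\sum_{i\in[k]}\lambda_i\|\hat{\bm{x}}_{i,j_i}-\bm{w}\|_2^2$, and define $$v(S)=\max_{\bm\gamma}\Big\{\sum_{i\in[k]}\sum_{j\in[|\Xi_i|]}\hat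 p_{ij}\gamma_{ij}:\ C_{\vec{\bm{j}}}(S)-\sum_{i\in[k]}\gamma_{ij_i}\ge0\ \ \forall\,\vec{\bm{j}}\in\prod_{i\in[k]}[|\Xi_i|]\Big\}.$$ This is the linear-programming dual of (and has the same value as) the problem of minimizing $\sum_{\vec{\bm{j}}}C_{\vec{\bm{j}}}(S)\Pi_{\vec{\bm{j}}}$ over nonnegative tensors $\bm\Pi$ whose $i$-th marginal is $(\hat p_{ij})_j$ for every $i\in[k]$. Since $t$ is a fixed constant, the constant in $O(\cdot)$ may depend on $t$ only. *)

theory Defs
  imports "HOL-Probability.Probability"
begin

(* The dimension d must be an ordinary variable, since it is quantified inside the scope of an
   existential constant. Points of R^d are therefore functions nat => real vanishing from index d
   on, i.e. elements of topspace (Euclidean_space d). *)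

definition edist :: "nat \<Rightarrow> (nat \<Rightarrow> real) \<Rightarrow> (nat \<Rightarrow> real) \<Rightarrow> real" where
  "edist d x y = L2_set (\<lambda>c. x c - y c) {..<d}"

definition euclid_borel :: "nat \<Rightarrow> (nat \<Rightarrow> real) measure" where
  "euclid_borel d = sigma (topspace (Euclidean_space d)) {U. openin (Euclidean_space d) U}"

definition P2 :: "nat \<Rightarrow> (nat \<Rightarrow> real) measure set" where
  "P2 d = {P. prob_space P \<and> sets P = sets (euclid_borel d) \<and>
              (\<integral>\<^sup>+x. ennreal ((edist d x (\<lambda>_. 0))\<^sup>2) \<partial>P) < \<infinity>}"

definition couplings ::
    "nat \<Rightarrow> (nat \<Rightarrow> real) measure \<Rightarrow> (nat \<Rightarrow> real) measure \<Rightarrow> ((nat \<Rightarrow> real) \<times> (nat \<Rightarrow> real)) measure set" where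
  "couplings d P Q = {\<pi>. sets \<pi> = sets (euclid_borel d \<Otimes>\<^sub>M euclid_borel d) \<and>
                         distr \<pi> (euclid_borel d) fst = P \<and> distr \<pi> (euclid_borel d) snd = Q}"

(* Meaningful for P and Q in P2 d, where the infimum is finite; outside P2 the conversion from
   ennreal may turn an infinite distance into 0. *)
definition W2 :: "nat \<Rightarrow> (nat \<Rightarrow> real) measure \<Rightarrow> (nat \<Rightarrow> real) measure \<Rightarrow> real" where
  "W2 d P Q = sqrt (enn2real
     (INF \<pi>\<in>couplings d P Q. \<integral>\<^sup>+z. ennreal ((edist d (fst z) (snd z))\<^sup>2) \<partial>\<pi>))"

(* The weighted sum of Dirac measures at x 1, ..., x m, see emeasure_discrete_measure. *)
definition discrete_measure ::
    "nat \<Rightarrow> nat \<Rightarrow> (nat \<Rightarrow> real) \<Rightarrow> (nat \<Rightarrow> nat \<Rightarrow> real) \<Rightarrow> (nat \<Rightarrow> real) measure" where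
  "discrete_measure d m p x =
     measure_of (space (euclid_borel d)) (sets (euclid_borel d))
       (\<lambda>A. \<Sum>j\<in>{1..m}. ennreal (p j) * emeasure (return (euclid_borel d) (x j)) A)"

definition barycenter_value ::
    "nat \<Rightarrow> nat \<Rightarrow> (nat \<Rightarrow> real) \<Rightarrow> (nat \<Rightarrow> (nat \<Rightarrow> real) measure) \<Rightarrow> real" where
  "barycenter_value d k lam Q = (INF P\<in>P2 d. \<Sum>i\<in>{1..k}. lam i * (W2 d P (Q i))\<^sup>2)"

(* Min is taken over the image of S, so tuple_cost is meant for finite nonempty S only. *)
definition tuple_cost ::
    "nat \<Rightarrow> nat \<Rightarrow> (nat \<Rightarrow> real) \<Rightarrow> (nat \<Rightarrow> nat \<Rightarrow> nat \<Rightarrow> real) \<Rightarrow> (nat \<Rightarrow> real) set \<Rightarrow> (nat \<Rightarrow> nat) \<Rightarrow> real" where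
  "tuple_cost d k lam x S j = Min ((\<lambda>w. \<Sum>i\<in>{1..k}. lam i * (edist d (x i (j i)) w)\<^sup>2) ` S)"

definition dual_feasible ::
    "nat \<Rightarrow> nat \<Rightarrow> (nat \<Rightarrow> real) \<Rightarrow> (nat \<Rightarrow> nat) \<Rightarrow> (nat \<Rightarrow> nat \<Rightarrow> nat \<Rightarrow> real) \<Rightarrow> (nat \<Rightarrow> real) set
     \<Rightarrow> (nat \<Rightarrow> nat \<Rightarrow> real) set" where
  "dual_feasible d k lam m x S =
     {\<gamma>. \<forall>j\<in>(\<Pi>\<^sub>E i\<in>{1..k}. {1..m i}). tuple_cost d k lam x S j - (\<Sum>i\<in>{1..k}. \<gamma> i (j i)) \<ge> 0}"

(* The supremum is a maximum, see dual_value_attained. *)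
definition dual_value ::
    "nat \<Rightarrow> nat \<Rightarrow> (nat \<Rightarrow> real) \<Rightarrow> (nat \<Rightarrow> nat) \<Rightarrow> (nat \<Rightarrow> nat \<Rightarrow> real) \<Rightarrow> (nat \<Rightarrow> nat \<Rightarrow> nat \<Rightarrow> real)
     \<Rightarrow> (nat \<Rightarrow> real) set \<Rightarrow> real" where
  "dual_value d k lam m p x S =
     (SUP \<gamma>\<in>dual_feasible d k lam m x S. \<Sum>i\<in>{1..k}. \<Sum>j\<in>{1..m i}. p i j * \<gamma> i j)"

definition S2 :: "nat \<Rightarrow> nat \<Rightarrow> (nat \<Rightarrow> (nat \<Rightarrow> real) set) \<Rightarrow> (nat \<Rightarrow> real) set" where
  "S2 t k \<Xi> = {(\<lambda>c. (1 / real t) * (\<Sum>i\<in>T. y i c)) | T y.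
                  T \<subseteq> {1..k} \<and> card T = t \<and> (\<forall>i\<in>T. y i \<in> \<Xi> i)}"

lemma sets_discrete_measure [simp]: "sets (discrete_measure d m p x) = sets (euclid_borel d)"
  by (simp add: discrete_measure_def)

lemma emeasure_discrete_measure:
  assumes A: "A \<in> sets (euclid_borel d)"
  shows "emeasure (discrete_measure d m p x) A = (\<Sum>j\<in>{1..m}. ennreal (p j) * indicator A (x j))"
proof -
  let ?B = "euclid_borel d"
  let ?\<mu> = "\<lambda>A. \<Sum>j\<in>{1..m}. ennreal (p j) * emeasure (return ?B (x j)) A"
  have "emeasure (discrete_measure d m p x) A = ?\<mu> A"
    unfolding discrete_measure_def
  proof (rule emeasure_measure_of_sigma)
    show "sigma_algebra (space ?B) (sets ?B)" by (rule sets.sigma_algebra_axioms)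
    show "positive (sets ?B) ?\<mu>" by (simp add: positive_def)
    show "countably_additive (sets ?B) ?\<mu>"
    proof (rule countably_additiveI)
      fix F :: "nat \<Rightarrow> (nat \<Rightarrow> real) set"
      assume F: "range F \<subseteq> sets ?B" "disjoint_family F"
      have "(\<Sum>i. ?\<mu> (F i)) = (\<Sum>j\<in>{1..m}. \<Sum>i. ennreal (p j) * emeasure (return ?B (x j)) (F i))"
        by (rule suminf_sum) simp
      also have "\<dots> = ?\<mu> (\<Union>i. F i)"
      proof (rule sum.cong)
        fix j
        have "(\<Sum>i. emeasure (return ?B (x j)) (F i)) = emeasure (return ?B (x j)) (\<Union>i. F i)"
          using F by (intro suminf_emeasure) auto
        then show "(\<Sum>i. ennreal (p j) * emeasure (return ?B (x j)) (F i))
            = ennreal (p j) * emeasure (return ?B (x j)) (\<Union>i. F i)"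
          by (simp only: ennreal_suminf_cmult)
      qed simp
      finally show "(\<Sum>i. ?\<mu> (F i)) = ?\<mu> (\<Union>i. F i)" .
    qed
  qed (use A in simp)
  then show ?thesis using A by simp
qed

lemma dual_value_attained:
  assumes k: "k \<ge> 1" and m: "\<And>i. i \<in> {1..k} \<Longrightarrow> m i \<ge> 1"
    and lam: "\<And>i. i \<in> {1..k} \<Longrightarrow> lam i \<ge> 0"
    and p: "\<And>i j. i \<in> {1..k} \<Longrightarrow> j \<in> {1..m i} \<Longrightarrow> p i j \<ge> 0"
    and p1: "\<And>i. i \<in> {1..k} \<Longrightarrow> (\<Sum>j\<in>{1..m i}. p i j) = 1"
    and S: "finite S" "S \<noteq> {}"
  shows "\<exists>\<gamma>\<in>dual_feasible d k lam m x S.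
           (\<Sum>i\<in>{1..k}. \<Sum>j\<in>{1..m i}. p i j * \<gamma> i j) = dual_value d k lam m p x S \<and>
           (\<forall>\<gamma>'\<in>dual_feasible d k lam m x S.
              (\<Sum>i\<in>{1..k}. \<Sum>j\<in>{1..m i}. p i j * \<gamma>' i j) \<le> (\<Sum>i\<in>{1..k}. \<Sum>j\<in>{1..m i}. p i j * \<gamma> i j))"
proof -
  let ?J = "\<Pi>\<^sub>E i\<in>{1..k}. {1..m i}"
  let ?C = "tuple_cost d k lam x S"
  let ?F = "dual_feasible d k lam m x S"
  let ?f = "\<lambda>\<gamma>::nat \<Rightarrow> nat \<Rightarrow> real. \<Sum>i\<in>{1..k}. \<Sum>j\<in>{1..m i}. p i j * \<gamma> i j"
  have finJ: "finite ?J" by (intro finite_PiE) auto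
  have C0: "?C j \<ge> 0" for j
    unfolding tuple_cost_def using S lam by (subst Min_ge_iff) (auto intro!: sum_nonneg mult_nonneg_nonneg)
  define M where "M = (\<Sum>j\<in>?J. ?C j)"
  have M: "?C j \<le> M" if "j \<in> ?J" for j
    unfolding M_def using C0 finJ that by (intro member_le_sum) auto
  have M0: "M \<ge> 0" unfolding M_def using C0 by (intro sum_nonneg) auto
  have F0: "(\<lambda>_ _. 0) \<in> ?F" using C0 by (simp add: dual_feasible_def)
  have cont: "continuous_on UNIV (\<lambda>\<gamma>::nat \<Rightarrow> nat \<Rightarrow> real. \<gamma> i j)" for i j
    by (rule continuous_on_product_then_coordinatewise
          [OF continuous_on_product_then_coordinatewise[OF continuous_on_id]])
  let ?K = "(\<Pi>\<^sub>E i\<in>UNIV. \<Pi>\<^sub>E j\<in>UNIV. {-M..M}) :: (nat \<Rightarrow> nat \<Rightarrow> real) set"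
  have compK: "compact ?K"
  proof -
    have 1: "compact ((\<Pi>\<^sub>E j\<in>UNIV. {-M..M}) :: (nat \<Rightarrow> real) set)"
      using compactin_PiE[of "\<lambda>_::nat. euclidean::real topology" UNIV "\<lambda>_. {-M..M}"]
      by (simp add: euclidean_product_topology)
    show ?thesis
      using compactin_PiE[of "\<lambda>_::nat. euclidean::(nat \<Rightarrow> real) topology" UNIV "\<lambda>_. \<Pi>\<^sub>E j\<in>UNIV. {-M..M}"] 1
      by (simp add: euclidean_product_topology)
  qed
  have closedF: "closed ?F"
    unfolding dual_feasible_def Ball_def
    by (intro closed_Collect_all closed_Collect_imp closed_Collect_le open_Collect_const
          continuous_intros cont)
  have "compact (?K \<inter> ?F)" using compK closedF by (rule compact_Int_closed)
  moreover have zero: "(\<lambda>_ _. 0) \<in> ?K \<inter> ?F" using F0 M0 by (auto simp: PiE_iff)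
  then have "?K \<inter> ?F \<noteq> {}" by blast
  moreover have "continuous_on (?K \<inter> ?F) ?f"
    by (intro continuous_intros continuous_on_subset[OF cont] subset_UNIV)
  ultimately obtain g where g: "g \<in> ?K \<inter> ?F" "\<And>h. h \<in> ?K \<inter> ?F \<Longrightarrow> ?f h \<le> ?f g"
    using continuous_attains_sup[of "?K \<inter> ?F" ?f] by blast
  have best: "?f h \<le> ?f g" if h: "h \<in> ?F" for h
  proof (cases "?f h \<le> 0")
    case True
    have "?f (\<lambda>_ _. 0) \<le> ?f g" by (rule g(2)[OF zero])
    with True show ?thesis by simp
  next
    case pos: False
    have hF: "(\<Sum>i\<in>{1..k}. h i (j i)) \<le> ?C j" if "j \<in> ?J" for j
    proof -
      have "\<forall>j\<in>?J. ?C j - (\<Sum>i\<in>{1..k}. h i (j i)) \<ge> 0"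
        using h unfolding dual_feasible_def by (rule CollectD)
      from bspec[OF this that] show ?thesis by linarith
    qed
    define b where "b i = Max (h i ` {1..m i})" for i
    have hb: "h i j \<le> b i" if "j \<in> {1..m i}" for i j
      unfolding b_def using that by (intro Max_ge) auto
    have "\<exists>j\<in>{1..m i}. b i = h i j" if "i \<in> {1..k}" for i
    proof -
      have "b i \<in> h i ` {1..m i}" unfolding b_def using m[OF that] by (intro Max_in) auto
      then show ?thesis by auto
    qed
    then have "\<forall>i\<in>{1..k}. \<exists>j. j \<in> {1..m i} \<and> b i = h i j" by blast
    from bchoice[OF this] obtain s where s: "\<And>i. i \<in> {1..k} \<Longrightarrow> s i \<in> {1..m i} \<and> b i = h i (s i)"
      by blast
    define G where "G = (\<Sum>i\<in>{1..k}. b i)"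
    have sJ: "restrict s {1..k} \<in> ?J" using s by auto
    have "G = (\<Sum>i\<in>{1..k}. h i (restrict s {1..k} i))"
      unfolding G_def using s by (intro sum.cong) auto
    also have "\<dots> \<le> ?C (restrict s {1..k})"
      using hF[OF sJ] .
    also have "\<dots> \<le> M" using M[OF sJ] .
    finally have GM: "G \<le> M" .
    have avg: "(\<Sum>j\<in>{1..m i}. p i j * c) = c" if "i \<in> {1..k}" for i c
      using p1[OF that] by (simp flip: sum_distrib_right)
    have "?f h \<le> (\<Sum>i\<in>{1..k}. \<Sum>j\<in>{1..m i}. p i j * b i)"
      using p hb by (intro sum_mono mult_left_mono) auto
    also have "\<dots> = G" unfolding G_def using avg by (intro sum.cong) auto
    finally have fG: "?f h \<le> G" .
    then have G0: "G > 0" using pos by simp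
    define q where "q i j = max (h i j) (b i - M)" for i j
    define r where "r i j = (if i \<in> {1..k} \<and> j \<in> {1..m i} then q i j - b i + G / k else 0)" for i j
    have qsum: "(\<Sum>i\<in>{1..k}. q i (j i)) \<le> ?C j" if j: "j \<in> ?J" for j
    proof (cases "\<exists>i\<in>{1..k}. q i (j i) \<noteq> h i (j i)")
      case False
      then have "(\<Sum>i\<in>{1..k}. q i (j i)) = (\<Sum>i\<in>{1..k}. h i (j i))" by (intro sum.cong) auto
      also have "\<dots> \<le> ?C j" using hF[OF j] .
      finally show ?thesis .
    next
      case True
      then obtain l where l: "l \<in> {1..k}" "q l (j l) \<noteq> h l (j l)" by blast
      then have ql: "q l (j l) = b l - M" unfolding q_def by (auto simp: max_def split: if_splits)
      have qb: "q i (j i) \<le> b i" if "i \<in> {1..k}" for i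
        using hb[of "j i" i] j that M0 unfolding q_def by (auto simp: PiE_iff)
      have "(\<Sum>i\<in>{1..k}. q i (j i)) = q l (j l) + (\<Sum>i\<in>{1..k}-{l}. q i (j i))"
        using l by (intro sum.remove) auto
      also have "\<dots> \<le> (b l - M) + (\<Sum>i\<in>{1..k}-{l}. b i)"
        using qb ql by (intro add_mono sum_mono) auto
      also have "\<dots> = G - M" unfolding G_def using l by (simp add: sum.remove[of _ l])
      finally show ?thesis using GM C0[of j] by linarith
    qed
    have "r \<in> ?F"
      unfolding dual_feasible_def
    proof (intro CollectI ballI)
      fix j assume j: "j \<in> ?J"
      have "(\<Sum>i\<in>{1..k}. r i (j i)) = (\<Sum>i\<in>{1..k}. q i (j i) - b i + G / k)"
        using j unfolding r_def by (intro sum.cong) (auto simp: PiE_iff)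
      also have "\<dots> = (\<Sum>i\<in>{1..k}. q i (j i)) - G + k * (G / k)"
        by (simp add: sum.distrib sum_subtractf G_def)
      also have "\<dots> = (\<Sum>i\<in>{1..k}. q i (j i))" using k by simp
      finally show "?C j - (\<Sum>i\<in>{1..k}. r i (j i)) \<ge> 0" using qsum[OF j] by simp
    qed
    moreover have "r \<in> ?K"
    proof -
      have k': "1 \<le> real k" using k by simp
      have "G * 1 \<le> G * real k" using mult_left_mono[OF k' less_imp_le[OF G0]] .
      with k' have "G / k \<le> G" by (simp add: divide_le_eq)
      then have Gk: "G / k \<le> M" "G / k \<ge> 0" using GM G0 by auto
      have "r i j \<in> {-M..M}" for i j
      proof (cases "i \<in> {1..k} \<and> j \<in> {1..m i}")
        case True
        then have "r i j = q i j - b i + G / k" unfolding r_def by simp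
        moreover have "q i j - b i \<le> 0" "q i j - b i \<ge> - M"
          using hb[of j i] True M0 unfolding q_def by auto
        ultimately show ?thesis using Gk by simp
      next
        case False
        then have "r i j = 0" unfolding r_def by (rule if_not_P)
        then show ?thesis using M0 by simp
      qed
      then show ?thesis by (simp add: PiE_iff)
    qed
    moreover have "?f h \<le> ?f r"
    proof -
      have "?f r = (\<Sum>i\<in>{1..k}. \<Sum>j\<in>{1..m i}. p i j * q i j + p i j * (G / k - b i))"
        unfolding r_def by (intro sum.cong) (auto simp: algebra_simps)
      also have "\<dots> = ?f q + (\<Sum>i\<in>{1..k}. G / k - b i)"
        using avg by (simp add: sum.distrib)
      also have "(\<Sum>i\<in>{1..k}. G / k - b i) = 0"
        using k by (simp add: sum_subtractf G_def)
      finally have "?f r = ?f q" by simp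
      moreover have "?f h \<le> ?f q"
        using p unfolding q_def by (intro sum_mono mult_left_mono) auto
      ultimately show ?thesis by simp
    qed
    ultimately show ?thesis using g(2)[of r] by (meson IntI order_trans)
  qed
  have "dual_value d k lam m p x S = ?f g"
    unfolding dual_value_def using g(1) best by (intro cSup_eq_maximum) auto
  then show ?thesis using g(1) best by (intro bexI[of _ g] conjI ballI) simp_all
qed

end

theory Submission
  imports Defs
begin

text \<open>Fix one point \<open>x\<^sub>i\<close> from each support. For a uniformly random set T of t indices, the mean of the
  \<open>x\<^sub>i\<close> with \<open>i \<in> T\<close> is an unbiased estimate of the overall mean whose variance is that of sampling
  without replacement, \<open>(k - t) / (t (k - 1))\<close> times the variance of the \<open>x\<^sub>i\<close>. Hence some such
  mean costs at most \<open>c = 1 + (k - t) / (t (k - 1))\<close> times as much as any point w of the space. This bound on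
  the tuple costs turns a feasible dual solution into Kantorovich potentials, scaled by c, for every
  candidate barycenter P, so that weak duality for the Wasserstein distances gives the claim; no
  gluing or disintegration of couplings is needed.\<close>

section \<open>Averaging over subsets of a fixed size\<close>

text \<open>Deleting i from T gives a (t - 1)-subset of \<open>A - {i, l}\<close>, and inserting i
  undoes this. What matters below is that the count is the same for every pair of distinct
  indices.\<close>

lemma card_subsets_separating:
  assumes A: "finite A" "i \<in> A" "l \<in> A" "i \<noteq> l" and t: "1 \<le> t"
  shows "card {T. T \<subseteq> A \<and> card T = t \<and> i \<in> T \<and> l \<notin> T} = (card A - 2) choose (t - 1)"
proof -
  let ?B = "{B. B \<subseteq> A - {i, l} \<and> card B = t - 1}"
  have fin: "finite B" if "B \<subseteq> A" for B
    using that A(1) by (rule finite_subset)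
  have "{T. T \<subseteq> A \<and> card T = t \<and> i \<in> T \<and> l \<notin> T} = insert i ` ?B" (is "?L = ?R")
  proof (intro set_eqI iffI)
    fix T assume T: "T \<in> ?L"
    then have "T - {i} \<in> ?B" "T = insert i (T - {i})" using fin[of T] by auto
    then show "T \<in> ?R" by blast
  next
    fix T assume "T \<in> ?R"
    then obtain B where B: "B \<in> ?B" "T = insert i B" by blast
    moreover have "finite B" using B(1) by (intro fin) auto
    moreover have "i \<notin> B" "l \<notin> B" using B(1) by auto
    ultimately show "T \<in> ?L" using A t by auto
  qed
  moreover have "inj_on (insert i) ?B" by (rule inj_onI) auto
  ultimately have "card ?L = card ?B" by (simp add: card_image)
  also have "\<dots> = card (A - {i, l}) choose (t - 1)" using A(1) by (intro n_subsets) simp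
  also have "card (A - {i, l}) = card A - 2" using A by (simp add: card_Diff_subset)
  finally show ?thesis .
qed

lemma sum_subsets_square_centered:
  fixes y :: "'a \<Rightarrow> real"
  assumes A: "finite A" and t: "1 \<le> t" and y0: "(\<Sum>i\<in>A. y i) = 0"
  shows "(\<Sum>T | T \<subseteq> A \<and> card T = t. (\<Sum>i\<in>T. y i)\<^sup>2)
    = real ((card A - 2) choose (t - 1)) * (\<Sum>i\<in>A. (y i)\<^sup>2)"
proof -
  let ?F = "{T. T \<subseteq> A \<and> card T = t}"
  let ?b = "real ((card A - 2) choose (t - 1))"
  have finF: "finite ?F" using A by simp
  \<comment> \<open>As y sums to zero, one of the two factors may be replaced by minus the sum over the complement
     of T. Only pairs of distinct indices remain, each separated by the same number of sets T.\<close>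
  have sq: "(\<Sum>i\<in>T. y i)\<^sup>2 = - (\<Sum>i\<in>A. \<Sum>l\<in>A. if i \<in> T \<and> l \<notin> T then y i * y l else 0)"
    if T: "T \<subseteq> A" for T
  proof -
    have "(\<Sum>l\<in>A. y l) = (\<Sum>l\<in>A - T. y l) + (\<Sum>l\<in>T. y l)"
      by (rule sum.subset_diff[OF T A])
    then have "(\<Sum>i\<in>T. y i)\<^sup>2 = - ((\<Sum>i\<in>T. y i) * (\<Sum>l\<in>A - T. y l))"
      using y0 by (simp add: power2_eq_square flip: minus_mult_right) algebra
    \<comment> \<open>Padding both sums with zeros makes the index sets independent of T, so that
      the sum over T can later be moved innermost.\<close>
    also have "(\<Sum>i\<in>T. y i) * (\<Sum>l\<in>A - T. y l)
        = (\<Sum>i\<in>A. if i \<in> T then y i else 0) * (\<Sum>l\<in>A. if l \<notin> T then y l else 0)"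
      using A T by (intro arg_cong2[where f = "(*)"] sum.mono_neutral_cong_left) auto
    also have "\<dots> = (\<Sum>i\<in>A. \<Sum>l\<in>A. if i \<in> T \<and> l \<notin> T then y i * y l else 0)"
      unfolding sum_product by (intro sum.cong) auto
    finally show ?thesis .
  qed
  have count: "(\<Sum>T\<in>?F. if i \<in> T \<and> l \<notin> T then y i * y l else 0)
      = (if i = l then 0 else ?b * (y i * y l))" if "i \<in> A" "l \<in> A" for i l
  proof -
    have "(\<Sum>T\<in>?F. if i \<in> T \<and> l \<notin> T then y i * y l else 0)
        = (\<Sum>T\<in>?F \<inter> {T. i \<in> T \<and> l \<notin> T}. y i * y l)"
      using finF by (simp add: sum.If_cases)
    also have "?F \<inter> {T. i \<in> T \<and> l \<notin> T} = {T. T \<subseteq> A \<and> card T = t \<and> i \<in> T \<and> l \<notin> T}" by auto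
    finally show ?thesis using card_subsets_separating[OF A that _ t] by auto
  qed
  \<comment> \<open>Centering enters a second time: the \<open>y l\<close> with l different from i
    add up to \<open>- y i\<close>, which turns the off-diagonal products into squares.\<close>
  have row: "(\<Sum>l\<in>A. if i = l then 0 else ?b * (y i * y l)) = - (?b * (y i)\<^sup>2)" if i: "i \<in> A" for i
  proof -
    have "(\<Sum>l\<in>A. if i = l then 0 else ?b * (y i * y l)) = (\<Sum>l\<in>A - {i}. ?b * (y i * y l))"
      using A by (intro sum.mono_neutral_cong_right) auto
    also have "\<dots> = ?b * (y i * (\<Sum>l\<in>A - {i}. y l))" by (simp add: sum_distrib_left)
    also have "(\<Sum>l\<in>A - {i}. y l) = - y i" using y0 A i by (simp add: sum_diff1)
    finally show ?thesis by (simp add: power2_eq_square)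
  qed
  have "(\<Sum>T\<in>?F. (\<Sum>i\<in>T. y i)\<^sup>2)
      = - (\<Sum>T\<in>?F. \<Sum>i\<in>A. \<Sum>l\<in>A. if i \<in> T \<and> l \<notin> T then y i * y l else 0)"
    using sq by (subst sum_negf[symmetric], intro sum.cong) auto
  also have "(\<Sum>T\<in>?F. \<Sum>i\<in>A. \<Sum>l\<in>A. if i \<in> T \<and> l \<notin> T then y i * y l else 0)
      = (\<Sum>i\<in>A. \<Sum>l\<in>A. \<Sum>T\<in>?F. if i \<in> T \<and> l \<notin> T then y i * y l else 0)"
    by (subst sum.swap, intro sum.cong refl, subst sum.swap) simp
  also have "\<dots> = (\<Sum>i\<in>A. - (?b * (y i)\<^sup>2))"
    using count row by (intro sum.cong) (auto cong: sum.cong)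
  finally show ?thesis by (simp add: sum_negf sum_distrib_left)
qed

text \<open>By two absorption identities both sides equal k (k - t) times the binomial coefficient
  of k - 1 over t - 1. Read as a probability, a uniformly random t-subset contains one given index
  and omits another with probability t (k - t) / (k (k - 1)).\<close>

lemma choose_two_step:
  fixes k t :: nat
  assumes "2 \<le> k" "1 \<le> t" "t \<le> k"
  shows "real k * (real k - 1) * real ((k - 2) choose (t - 1))
    = real t * (real k - real t) * real (k choose t)"
proof -
  have "t * (k choose t) = k * ((k - 1) choose (t - 1))"
    using binomial_absorption[of "t - 1" k] assms by simp
  moreover have "(k - t) * ((k - 1) choose (t - 1)) = (k - 1) * ((k - 2) choose (t - 1))"
    using binomial_absorb_comp[of "k - 1" "t - 1"] assms by (simp add: numeral_2_eq_2)
  ultimately have 1: "real t * real (k choose t) = real k * real ((k - 1) choose (t - 1))"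
    and 2: "real (k - t) * real ((k - 1) choose (t - 1)) = real (k - 1) * real ((k - 2) choose (t - 1))"
    by (simp_all only: flip: of_nat_mult)
  have "real k * (real k - 1) * real ((k - 2) choose (t - 1))
      = real k * (real (k - 1) * real ((k - 2) choose (t - 1)))"
    using assms by (simp add: of_nat_diff)
  also have "\<dots> = real (k - t) * (real k * real ((k - 1) choose (t - 1)))"
    by (simp only: 2[symmetric] mult.left_commute)
  also have "\<dots> = real (k - t) * (real t * real (k choose t))"
    by (simp only: 1)
  also have "\<dots> = real t * (real k - real t) * real (k choose t)"
    using assms by (simp add: of_nat_diff)
  finally show ?thesis .
qed

text \<open>The cross term vanishes because m is the mean. This is used both for w a subset mean,
  where the last term is the excess cost, and for arbitrary w, where it is dropped.\<close>

lemma sum_squares_about: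
  fixes x :: "'a \<Rightarrow> real"
  assumes "(\<Sum>i\<in>A. x i - m) = 0"
  shows "(\<Sum>i\<in>A. (x i - w)\<^sup>2) = (\<Sum>i\<in>A. (x i - m)\<^sup>2) + real (card A) * (m - w)\<^sup>2"
proof -
  have "(\<Sum>i\<in>A. (x i - w)\<^sup>2) = (\<Sum>i\<in>A. (x i - m)\<^sup>2 + 2 * (m - w) * (x i - m) + (m - w)\<^sup>2)"
    by (intro sum.cong) (auto simp: power2_eq_square algebra_simps)
  also have "\<dots> = (\<Sum>i\<in>A. (x i - m)\<^sup>2) + 2 * (m - w) * (\<Sum>i\<in>A. x i - m) + real (card A) * (m - w)\<^sup>2"
    by (simp add: sum.distrib sum_distrib_left)
  finally show ?thesis using assms by simp
qed

text \<open>This treats a single coordinate. It bounds the total over all T instead of asserting a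
  good T, because different coordinates may favour different sets, whereas totals can be added over
  the coordinates.\<close>

lemma sum_subset_means_cost_le:
  fixes x :: "'a \<Rightarrow> real"
  assumes A: "finite A" and k: "2 \<le> card A" and t: "1 \<le> t" "t \<le> card A"
  shows "(\<Sum>T | T \<subseteq> A \<and> card T = t. \<Sum>i\<in>A. (x i - (1 / real t) * (\<Sum>l\<in>T. x l))\<^sup>2)
    \<le> real (card A choose t) * ((1 + (real (card A) - real t) / (real t * (real (card A) - 1)))
        * (\<Sum>i\<in>A. (x i - w)\<^sup>2))"
proof -
  let ?k = "real (card A)" and ?F = "{T. T \<subseteq> A \<and> card T = t}"
  let ?c = "1 + (?k - real t) / (real t * (?k - 1))"
  define m where "m = (\<Sum>i\<in>A. x i) / ?k"
  define V where "V = (\<Sum>i\<in>A. (x i - m)\<^sup>2)"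
  have k0: "?k > 1" "real t > 0" using k t by auto
  have m0: "(\<Sum>i\<in>A. x i - m) = 0" using k0 by (simp add: sum_subtractf m_def)
  have cost: "(\<Sum>i\<in>A. (x i - (1 / real t) * (\<Sum>l\<in>T. x l))\<^sup>2)
      = V + ?k / (real t)\<^sup>2 * (\<Sum>l\<in>T. x l - m)\<^sup>2" if "T \<in> ?F" for T
  proof -
    have d: "(\<Sum>l\<in>T. x l - m) = (\<Sum>l\<in>T. x l) - real t * m"
      using that by (simp add: sum_subtractf)
    have "m - (1 / real t) * (\<Sum>l\<in>T. x l) = - ((\<Sum>l\<in>T. x l - m) / real t)"
      unfolding d using k0 by (simp add: field_simps)
    then have "(m - (1 / real t) * (\<Sum>l\<in>T. x l))\<^sup>2 = (\<Sum>l\<in>T. x l - m)\<^sup>2 / (real t)\<^sup>2"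
      by (simp only: power2_minus power_divide)
    then show ?thesis
      using sum_squares_about[OF m0, of "(1 / real t) * (\<Sum>l\<in>T. x l)"] by (simp add: V_def)
  qed
  have "(\<Sum>T\<in>?F. \<Sum>i\<in>A. (x i - (1 / real t) * (\<Sum>l\<in>T. x l))\<^sup>2)
      = (\<Sum>T\<in>?F. V + ?k / (real t)\<^sup>2 * (\<Sum>l\<in>T. x l - m)\<^sup>2)"
    by (intro sum.cong cost refl)
  also have "\<dots> = real (card A choose t) * V + ?k / (real t)\<^sup>2 * (\<Sum>T\<in>?F. (\<Sum>l\<in>T. x l - m)\<^sup>2)"
    using n_subsets[OF A, of t] by (simp add: sum.distrib sum_distrib_left)
  also have "(\<Sum>T\<in>?F. (\<Sum>l\<in>T. x l - m)\<^sup>2) = real ((card A - 2) choose (t - 1)) * V"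
    unfolding V_def by (rule sum_subsets_square_centered[OF A t(1) m0])
  also have "real ((card A - 2) choose (t - 1))
      = real t * (?k - real t) * real (card A choose t) / (?k * (?k - 1))"
    using choose_two_step[OF k t] k0 by (simp add: eq_divide_eq mult.commute)
  \<comment> \<open>Here k / t^2 times t (k - t) / (k (k - 1)) becomes (k - t) / (t (k - 1)), the
    excess of the constant over 1.\<close>
  also have "real (card A choose t) * V
      + ?k / (real t)\<^sup>2 * (real t * (?k - real t) * real (card A choose t) / (?k * (?k - 1)) * V)
      = real (card A choose t) * (?c * V)"
    using k0 by (simp add: divide_simps power2_eq_square) (simp add: algebra_simps)
  also have "\<dots> \<le> real (card A choose t) * (?c * (\<Sum>i\<in>A. (x i - w)\<^sup>2))"
  proof (intro mult_left_mono)
    show "V \<le> (\<Sum>i\<in>A. (x i - w)\<^sup>2)"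
      using sum_squares_about[OF m0, of w] by (simp add: V_def)
    show "0 \<le> ?c" using k0 t by (auto intro!: add_nonneg_nonneg divide_nonneg_nonneg)
  qed simp
  finally show ?thesis .
qed

section \<open>The squared Euclidean distance\<close>

lemma edist_squared: "(edist d x y)\<^sup>2 = (\<Sum>c<d. (x c - y c)\<^sup>2)"
  by (simp add: edist_def L2_set_def sum_nonneg)

lemma edist_commute: "edist d x y = edist d y x"
  by (simp add: edist_def L2_set_def power2_commute)

text \<open>Coordinatewise this is (a + b)^2 >= 0 rearranged. It makes finite second moments
  sufficient for integrability of the squared distance, first to a fixed point and then under a
  coupling.\<close>

lemma edist_squared_le: "(edist d x y)\<^sup>2 \<le> 2 * (edist d x (\<lambda>_. 0))\<^sup>2 + 2 * (edist d y (\<lambda>_. 0))\<^sup>2"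
proof -
  have "(x c - y c)\<^sup>2 \<le> 2 * (x c)\<^sup>2 + 2 * (y c)\<^sup>2" for c
    using zero_le_power2[of "x c + y c"] by (simp add: power2_eq_square algebra_simps)
  then show ?thesis
    unfolding edist_squared by (auto simp: sum_distrib_left simp flip: sum.distrib intro!: sum_mono)
qed

text \<open>If every T exceeded the bound, so would the total over all T, against the coordinatewise
  totals summed over the d coordinates.\<close>

lemma ex_subset_mean_cost_le:
  fixes x :: "'a \<Rightarrow> nat \<Rightarrow> real"
  assumes A: "finite A" and k: "2 \<le> card A" and t: "1 \<le> t" "t \<le> card A"
  shows "\<exists>T. T \<subseteq> A \<and> card T = t \<and>
    (\<Sum>i\<in>A. (edist d (x i) (\<lambda>c. (1 / real t) * (\<Sum>l\<in>T. x l c)))\<^sup>2)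
    \<le> (1 + (real (card A) - real t) / (real t * (real (card A) - 1))) * (\<Sum>i\<in>A. (edist d (x i) w)\<^sup>2)"
proof (rule ccontr)
  let ?F = "{T. T \<subseteq> A \<and> card T = t}"
  let ?s = "\<lambda>T c. (1 / real t) * (\<Sum>l\<in>T. x l c)"
  let ?c = "1 + (real (card A) - real t) / (real t * (real (card A) - 1))"
  let ?W = "\<Sum>i\<in>A. (edist d (x i) w)\<^sup>2"
  have card: "card ?F = card A choose t" using A by (rule n_subsets)
  have finF: "finite ?F" using A by simp
  \<comment> \<open>The strict inequality survives summation only over a nonempty family, which is
    where t <= \<open>card A\<close> enters.\<close>
  moreover have "?F \<noteq> {}" using card t by (metis binomial_eq_0_iff card.empty not_le)
  moreover assume "\<not> ?thesis"
  then have "?c * ?W < (\<Sum>i\<in>A. (edist d (x i) (?s T))\<^sup>2)" if "T \<in> ?F" for T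
    using that by (auto simp: not_le)
  ultimately have "(\<Sum>T\<in>?F. ?c * ?W) < (\<Sum>T\<in>?F. \<Sum>i\<in>A. (edist d (x i) (?s T))\<^sup>2)"
    by (intro sum_strict_mono) blast+
  also have "\<dots> = (\<Sum>T\<in>?F. \<Sum>c<d. \<Sum>i\<in>A. (x i c - ?s T c)\<^sup>2)"
    unfolding edist_squared by (intro sum.cong refl sum.swap)
  also have "\<dots> = (\<Sum>c<d. \<Sum>T\<in>?F. \<Sum>i\<in>A. (x i c - ?s T c)\<^sup>2)"
    by (rule sum.swap)
  also have "\<dots> \<le> (\<Sum>c<d. real (card A choose t) * (?c * (\<Sum>i\<in>A. (x i c - w c)\<^sup>2)))"
    by (intro sum_mono sum_subset_means_cost_le A k t)
  also have "\<dots> = (\<Sum>T\<in>?F. ?c * (\<Sum>c<d. \<Sum>i\<in>A. (x i c - w c)\<^sup>2))"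
    by (simp add: card sum_distrib_left)
  also have "(\<Sum>c<d. \<Sum>i\<in>A. (x i c - w c)\<^sup>2) = ?W"
    unfolding edist_squared by (rule sum.swap)
  finally show False by simp
qed

section \<open>Measures with finite second moment\<close>

lemma space_euclid_borel [simp]: "space (euclid_borel d) = topspace (Euclidean_space d)"
  unfolding euclid_borel_def by (rule space_measure_of) (auto dest: openin_subset)

lemma sets_euclid_borel:
  "sets (euclid_borel d) = sigma_sets (topspace (Euclidean_space d)) {U. openin (Euclidean_space d) U}"
  unfolding euclid_borel_def by (rule sets_measure_of) (auto dest: openin_subset)

lemma measurable_coordinate [measurable]: "(\<lambda>x. x c) \<in> borel_measurable (euclid_borel d)"
proof (rule borel_measurableI)
  fix S :: "real set" assume S: "open S"
  have "continuous_map (Euclidean_space d) euclideanreal (\<lambda>x. x c)"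
    unfolding Euclidean_space_def
    by (intro continuous_map_from_subtopology continuous_map_product_projection) simp
  then have "openin (Euclidean_space d) {x \<in> topspace (Euclidean_space d). x c \<in> S}"
    using S by (intro openin_continuous_map_preimage) auto
  moreover have "(\<lambda>x. x c) -` S \<inter> space (euclid_borel d) = {x \<in> topspace (Euclidean_space d). x c \<in> S}"
    by auto
  ultimately show "(\<lambda>x. x c) -` S \<inter> space (euclid_borel d) \<in> sets (euclid_borel d)"
    unfolding sets_euclid_borel by auto
qed

lemma measurable_edist_squared [measurable]:
  assumes [measurable]: "f \<in> M \<rightarrow>\<^sub>M euclid_borel d" "g \<in> M \<rightarrow>\<^sub>M euclid_borel d"
  shows "(\<lambda>z. (edist d (f z) (g z))\<^sup>2) \<in> borel_measurable M"
  unfolding edist_squared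
  by (intro borel_measurable_sum borel_measurable_power borel_measurable_diff
      measurable_compose[OF assms(1)] measurable_compose[OF assms(2)] measurable_coordinate)

lemma singleton_sets_euclid_borel:
  assumes x: "x \<in> topspace (Euclidean_space d)"
  shows "{x} \<in> sets (euclid_borel d)"
proof -
  \<comment> \<open>Only countably many coordinates have to agree, so the singleton is a countable
    intersection of measurable sets.\<close>
  have "{x} = {y \<in> space (euclid_borel d). \<forall>c. y c = x c}" using x by auto
  also have "\<dots> \<in> sets (euclid_borel d)" by measurable
  finally show ?thesis .
qed

lemma P2_space: "P \<in> P2 d \<Longrightarrow> space P = topspace (Euclidean_space d)"
  by (auto simp: P2_def dest: sets_eq_imp_space_eq)

lemma P2_integrable_edist_squared:
  assumes P: "P \<in> P2 d" and x: "x \<in> topspace (Euclidean_space d)"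
  shows "integrable P (\<lambda>w. (edist d w x)\<^sup>2)"
proof -
  interpret prob_space P using P by (simp add: P2_def)
  have [measurable_cong]: "sets P = sets (euclid_borel d)" using P by (simp add: P2_def)
  have id: "(\<lambda>w. w) \<in> P \<rightarrow>\<^sub>M euclid_borel d" by (rule measurable_ident_sets) fact
  have meas: "(\<lambda>w. (edist d w y)\<^sup>2) \<in> borel_measurable P" if "y \<in> topspace (Euclidean_space d)" for y
    using that id by (intro measurable_edist_squared) auto
  have "(\<lambda>_. 0) \<in> topspace (Euclidean_space d)" by (simp add: topspace_Euclidean_space)
  then have "integrable P (\<lambda>w. (edist d w (\<lambda>_. 0))\<^sup>2)"
    using P meas by (intro integrableI_nonneg) (auto simp: P2_def)
  then have "integrable P (\<lambda>w. 2 * (edist d w (\<lambda>_. 0))\<^sup>2 + 2 * (edist d x (\<lambda>_. 0))\<^sup>2)"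
    by simp
  then show ?thesis
    by (rule Bochner_Integration.integrable_bound) (use meas[OF x] edist_squared_le[of d _ x] in auto)
qed

section \<open>Finitely supported probability measures\<close>

lemma AE_discrete_measure:
  assumes x: "\<And>j. j \<in> {1..m} \<Longrightarrow> x j \<in> topspace (Euclidean_space d)"
  shows "AE y in discrete_measure d m p x. y \<in> x ` {1..m}"
proof (rule AE_I)
  let ?Q = "discrete_measure d m p x"
  have "x ` {1..m} \<in> sets (euclid_borel d)"
    using x singleton_sets_euclid_borel[of _ d]
    by (subst UN_singleton[symmetric], intro sets.finite_UN) auto
  then have s: "space ?Q - x ` {1..m} \<in> sets ?Q"
    by (metis sets_discrete_measure sets.compl_sets)
  show "{y \<in> space ?Q. y \<notin> x ` {1..m}} \<subseteq> space ?Q - x ` {1..m}" by auto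
  show "space ?Q - x ` {1..m} \<in> sets ?Q" by (rule s)
  show "emeasure ?Q (space ?Q - x ` {1..m}) = 0"
    using s by (subst emeasure_discrete_measure) (auto intro!: sum.neutral)
qed

lemma discrete_measure_in_P2:
  assumes x: "\<And>j. j \<in> {1..m} \<Longrightarrow> x j \<in> topspace (Euclidean_space d)"
    and p: "\<And>j. j \<in> {1..m} \<Longrightarrow> 0 \<le> p j" "(\<Sum>j\<in>{1..m}. p j) = 1"
  shows "discrete_measure d m p x \<in> P2 d"
proof -
  let ?Q = "discrete_measure d m p x"
  let ?f = "\<lambda>y. (edist d y (\<lambda>_. 0))\<^sup>2"
  have sp: "space ?Q = space (euclid_borel d)"
    by (rule sets_eq_imp_space_eq[OF sets_discrete_measure])
  have "emeasure ?Q (space ?Q) = (\<Sum>j\<in>{1..m}. ennreal (p j))"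
    unfolding sp using x by (subst emeasure_discrete_measure[OF sets.top]) (auto intro!: sum.cong)
  also have "\<dots> = 1" using p by (subst sum_ennreal) auto
  finally have prob: "prob_space ?Q" by (rule prob_spaceI)
  then interpret prob_space ?Q .
  define M where "M = (\<Sum>j\<in>{1..m}. ?f (x j))"
  have "AE y in ?Q. y \<in> x ` {1..m}" using x by (rule AE_discrete_measure)
  then have "AE y in ?Q. ennreal (?f y) \<le> ennreal M"
  proof eventually_elim
    case (elim y)
    then obtain j where "j \<in> {1..m}" "y = x j" by blast
    then have "?f y \<le> M" unfolding M_def by (auto intro!: member_le_sum)
    then show ?case by (rule ennreal_leI)
  qed
  then have "(\<integral>\<^sup>+y. ennreal (?f y) \<partial>?Q) \<le> (\<integral>\<^sup>+y. ennreal M \<partial>?Q)"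
    by (rule nn_integral_mono_AE)
  also have "\<dots> < \<infinity>" by (simp add: emeasure_space_1)
  finally show ?thesis using prob by (simp add: P2_def)
qed

text \<open>Such a g lets a vector of dual variables act as a potential on the whole space.
  Injectivity of x makes the mass of \<open>{x j}\<close> exactly \<open>p j\<close>; with repeated
  points several weights would accumulate.\<close>

lemma discrete_measure_indicator_sum:
  fixes a :: "nat \<Rightarrow> real"
  assumes x: "\<And>j. j \<in> {1..m} \<Longrightarrow> x j \<in> topspace (Euclidean_space d)" and inj: "inj_on x {1..m}"
    and p: "\<And>j. j \<in> {1..m} \<Longrightarrow> 0 \<le> p j" "(\<Sum>j\<in>{1..m}. p j) = 1"
  defines "g \<equiv> \<lambda>y. \<Sum>j\<in>{1..m}. a j * indicator {x j} y :: real"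
  shows "integrable (discrete_measure d m p x) g"
    and "(\<integral>y. g y \<partial>discrete_measure d m p x) = (\<Sum>j\<in>{1..m}. p j * a j)"
proof -
  let ?Q = "discrete_measure d m p x"
  interpret prob_space ?Q using discrete_measure_in_P2[OF x p] by (simp add: P2_def)
  have s: "{x j} \<in> sets ?Q" if "j \<in> {1..m}" for j
    using singleton_sets_euclid_borel[OF x[OF that]] by simp
  have int: "integrable ?Q (\<lambda>y. a j * indicator {x j} y)" if "j \<in> {1..m}" for j
    using s[OF that] by (intro integrable_mult_right integrable_real_indicator) (auto simp: less_top[symmetric])
  then show "integrable ?Q g" unfolding g_def by (rule Bochner_Integration.integrable_sum)
  have meas: "measure ?Q {x j} = p j" if j: "j \<in> {1..m}" for j
  proof -
    have "emeasure ?Q {x j} = (\<Sum>l\<in>{1..m}. ennreal (p l) * indicator {x j} (x l))"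
      using s[OF j] by (intro emeasure_discrete_measure) simp
    also have "\<dots> = (\<Sum>l\<in>{1..m}. if l = j then ennreal (p l) else 0)"
      using inj j by (intro sum.cong) (auto simp: inj_on_eq_iff indicator_def)
    also have "\<dots> = ennreal (p j)" using j by simp
    finally show ?thesis using p(1)[OF j] by (simp add: measure_def)
  qed
  have "(\<integral>y. g y \<partial>?Q) = (\<Sum>j\<in>{1..m}. \<integral>y. a j * indicator {x j} y \<partial>?Q)"
    unfolding g_def using int by (rule Bochner_Integration.integral_sum)
  also have "\<dots> = (\<Sum>j\<in>{1..m}. p j * a j)"
    using s meas by (intro sum.cong) (auto simp: sets.Int_space_eq2)
  finally show "(\<integral>y. g y \<partial>?Q) = (\<Sum>j\<in>{1..m}. p j * a j)" .
qed

section \<open>Weak duality\<close>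

text \<open>The independent coupling shows that the infimum defining \<open>W2\<close> ranges over a
  nonempty set.\<close>

lemma pair_measure_in_couplings:
  assumes "P \<in> P2 d" "Q \<in> P2 d"
  shows "P \<Otimes>\<^sub>M Q \<in> couplings d P Q"
proof -
  interpret P: prob_space P using assms by (simp add: P2_def)
  interpret Q: prob_space Q using assms by (simp add: P2_def)
  interpret pair_sigma_finite P Q ..
  have s: "sets P = sets (euclid_borel d)" "sets Q = sets (euclid_borel d)"
    using assms by (auto simp: P2_def)
  have "distr (P \<Otimes>\<^sub>M Q) (euclid_borel d) fst = distr (P \<Otimes>\<^sub>M Q) P fst"
    using s by (intro distr_cong) auto
  also have "\<dots> = P" by (rule Q.distr_pair_fst)
  finally have 1: "distr (P \<Otimes>\<^sub>M Q) (euclid_borel d) fst = P" .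
  have "distr (P \<Otimes>\<^sub>M Q) (euclid_borel d) snd = distr (P \<Otimes>\<^sub>M Q) Q snd"
    using s by (intro distr_cong) auto
  \<comment> \<open>The second marginal is reduced to a first marginal by swapping the two
    factors.\<close>
  also have "\<dots> = distr (distr (Q \<Otimes>\<^sub>M P) (P \<Otimes>\<^sub>M Q) (\<lambda>(x, y). (y, x))) Q snd"
    using distr_pair_swap by simp
  also have "\<dots> = distr (Q \<Otimes>\<^sub>M P) Q (snd \<circ> (\<lambda>(x, y). (y, x)))"
    by (rule distr_distr) auto
  also have "\<dots> = distr (Q \<Otimes>\<^sub>M P) Q fst" by (intro distr_cong) auto
  also have "\<dots> = Q" by (rule P.distr_pair_fst)
  finally show ?thesis
    unfolding couplings_def using 1 s sets_pair_measure_cong[of P "euclid_borel d" Q "euclid_borel d"]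
    by simp
qed

text \<open>Potentials depend on one component only, so change of variables reduces them to the
  marginals. The quadratic cost is dominated by the second moments of P and Q, hence integrable
  under every coupling.\<close>

lemma couplings_integrable:
  assumes \<pi>: "\<pi> \<in> couplings d P Q" and PQ: "P \<in> P2 d" "Q \<in> P2 d"
  shows "integrable P \<phi> \<Longrightarrow> integrable \<pi> (\<lambda>z. \<phi> (fst z) :: real)"
    and "integrable P \<phi> \<Longrightarrow> (\<integral>z. \<phi> (fst z) \<partial>\<pi>) = (\<integral>w. \<phi> w \<partial>P)"
    and "integrable Q \<psi> \<Longrightarrow> integrable \<pi> (\<lambda>z. \<psi> (snd z) :: real)"
    and "integrable Q \<psi> \<Longrightarrow> (\<integral>z. \<psi> (snd z) \<partial>\<pi>) = (\<integral>y. \<psi> y \<partial>Q)"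
    and "integrable \<pi> (\<lambda>z. (edist d (fst z) (snd z))\<^sup>2)"
proof -
  have [measurable_cong]: "sets \<pi> = sets (euclid_borel d \<Otimes>\<^sub>M euclid_borel d)"
    and fst: "distr \<pi> (euclid_borel d) fst = P" and snd: "distr \<pi> (euclid_borel d) snd = Q"
    using \<pi> by (auto simp: couplings_def)
  have [measurable]: "fst \<in> \<pi> \<rightarrow>\<^sub>M euclid_borel d" "snd \<in> \<pi> \<rightarrow>\<^sub>M euclid_borel d" by simp_all
  have s: "sets P = sets (euclid_borel d)" "sets Q = sets (euclid_borel d)"
    using PQ by (auto simp: P2_def)
  show A: "integrable \<pi> (\<lambda>z. \<phi> (fst z))" if "integrable P \<phi>" for \<phi> :: "(nat \<Rightarrow> real) \<Rightarrow> real"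
    using that by (intro integrable_distr[of fst \<pi> "euclid_borel d"]) (simp_all add: fst)
  show B: "integrable \<pi> (\<lambda>z. \<psi> (snd z))" if "integrable Q \<psi>" for \<psi> :: "(nat \<Rightarrow> real) \<Rightarrow> real"
    using that by (intro integrable_distr[of snd \<pi> "euclid_borel d"]) (simp_all add: snd)
  show "(\<integral>z. \<phi> (fst z) \<partial>\<pi>) = (\<integral>w. \<phi> w \<partial>P)" if "integrable P \<phi>"
    using that borel_measurable_integrable[OF that] integral_distr[of fst \<pi> "euclid_borel d" \<phi>] s
    by (simp add: fst cong: measurable_cong_sets)
  show "(\<integral>z. \<psi> (snd z) \<partial>\<pi>) = (\<integral>y. \<psi> y \<partial>Q)" if "integrable Q \<psi>"
    using that borel_measurable_integrable[OF that] integral_distr[of snd \<pi> "euclid_borel d" \<psi>] s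
    by (simp add: snd cong: measurable_cong_sets)
  have 0: "(\<lambda>_. 0) \<in> topspace (Euclidean_space d)" by (simp add: topspace_Euclidean_space)
  have "integrable \<pi> (\<lambda>z. 2 * (edist d (fst z) (\<lambda>_. 0))\<^sup>2 + 2 * (edist d (snd z) (\<lambda>_. 0))\<^sup>2)"
    using A[OF P2_integrable_edist_squared[OF PQ(1) 0]] B[OF P2_integrable_edist_squared[OF PQ(2) 0]]
    by simp
  then show "integrable \<pi> (\<lambda>z. (edist d (fst z) (snd z))\<^sup>2)"
    by (rule Bochner_Integration.integrable_bound) (use edist_squared_le in auto)
qed

text \<open>Every coupling has finite cost and there is at least one, so passing through
  \<open>ennreal\<close> and back loses nothing and the infimum may be taken over the reals.\<close>

lemma W2_squared:
  assumes PQ: "P \<in> P2 d" "Q \<in> P2 d"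
  shows "(W2 d P Q)\<^sup>2 = (INF \<pi>\<in>couplings d P Q. \<integral>z. (edist d (fst z) (snd z))\<^sup>2 \<partial>\<pi>)"
proof -
  let ?I = "\<lambda>\<pi>. \<integral>z. (edist d (fst z) (snd z))\<^sup>2 \<partial>\<pi>"
  have ne: "couplings d P Q \<noteq> {}" using pair_measure_in_couplings[OF PQ] by blast
  have I0: "0 \<le> ?I \<pi>" for \<pi> by simp
  have "(INF \<pi>\<in>couplings d P Q. \<integral>\<^sup>+z. ennreal ((edist d (fst z) (snd z))\<^sup>2) \<partial>\<pi>)
      = (INF \<pi>\<in>couplings d P Q. ennreal (?I \<pi>))"
    by (intro INF_cong refl nn_integral_eq_integral couplings_integrable(5)[OF _ PQ]) auto
  also have "\<dots> = ennreal (INF \<pi>\<in>couplings d P Q. ?I \<pi>)"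
  proof (rule antisym)
    show "ennreal (INF \<pi>\<in>couplings d P Q. ?I \<pi>) \<le> (INF \<pi>\<in>couplings d P Q. ennreal (?I \<pi>))"
      using I0 by (intro INF_greatest ennreal_leI cINF_lower bdd_belowI2[where m = 0])
    \<comment> \<open>The extended infimum is finite, being bounded by the cost of any one
      coupling.\<close>
    obtain r where r: "0 \<le> r" "(INF \<pi>\<in>couplings d P Q. ennreal (?I \<pi>)) = ennreal r"
    proof (cases "INF \<pi>\<in>couplings d P Q. ennreal (?I \<pi>)" rule: ennreal_cases)
      case top
      moreover obtain \<pi> where "\<pi> \<in> couplings d P Q" using ne by blast
      ultimately show ?thesis
        using INF_lower[of \<pi> "couplings d P Q" "\<lambda>\<pi>. ennreal (?I \<pi>)"] by (simp add: top_unique)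
    qed
    have "r \<le> ?I \<pi>" if "\<pi> \<in> couplings d P Q" for \<pi>
      using INF_lower[OF that, of "\<lambda>\<pi>. ennreal (?I \<pi>)"] r I0 by simp
    then show "(INF \<pi>\<in>couplings d P Q. ennreal (?I \<pi>)) \<le> ennreal (INF \<pi>\<in>couplings d P Q. ?I \<pi>)"
      unfolding r(2) by (intro ennreal_leI cINF_greatest[OF ne])
  qed
  finally show ?thesis
    unfolding W2_def using ne by (simp add: cINF_greatest[OF ne I0])
qed

text \<open>This is the easy half of Kantorovich duality: integrate the pointwise inequality against
  an arbitrary coupling. The inequality is asked for almost every y only, since the potential used
  for a discrete Q has the right values just on its support.\<close>

lemma integral_potentials_le_W2:
  assumes PQ: "P \<in> P2 d" "Q \<in> P2 d" and int: "integrable P \<phi>" "integrable Q \<psi>" and a: "0 \<le> a"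
    and le: "AE y in Q. \<forall>w\<in>topspace (Euclidean_space d). \<phi> w + \<psi> y \<le> a * (edist d w y)\<^sup>2"
  shows "(\<integral>w. \<phi> w \<partial>P) + (\<integral>y. \<psi> y \<partial>Q) \<le> a * (W2 d P Q)\<^sup>2"
proof -
  let ?I = "\<lambda>\<pi>. \<integral>z. (edist d (fst z) (snd z))\<^sup>2 \<partial>\<pi>"
  let ?r = "(\<integral>w. \<phi> w \<partial>P) + (\<integral>y. \<psi> y \<partial>Q)"
  have ne: "couplings d P Q \<noteq> {}" using pair_measure_in_couplings[OF PQ] by blast
  have bound: "?r \<le> a * ?I \<pi>" if \<pi>: "\<pi> \<in> couplings d P Q" for \<pi>
  proof -
    note ci = couplings_integrable[OF \<pi> PQ]
    have sets: "sets \<pi> = sets (euclid_borel d \<Otimes>\<^sub>M euclid_borel d)"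
      and snd: "distr \<pi> (euclid_borel d) snd = Q"
      using \<pi> by (auto simp: couplings_def)
    have [measurable_cong]: "sets \<pi> = sets (euclid_borel d \<Otimes>\<^sub>M euclid_borel d)" by (rule sets)
    have "snd \<in> \<pi> \<rightarrow>\<^sub>M euclid_borel d" by simp
    then have AE: "AE z in \<pi>. \<forall>w\<in>topspace (Euclidean_space d). \<phi> w + \<psi> (snd z) \<le> a * (edist d w (snd z))\<^sup>2"
      by (rule AE_distrD) (unfold snd, rule le)
    have "space \<pi> = topspace (Euclidean_space d) \<times> topspace (Euclidean_space d)"
      using sets_eq_imp_space_eq[OF sets] by (simp add: space_pair_measure)
    then have "AE z in \<pi>. fst z \<in> topspace (Euclidean_space d)" by (intro AE_I2) (simp add: mem_Times_iff)
    with AE have "AE z in \<pi>. \<phi> (fst z) + \<psi> (snd z) \<le> a * (edist d (fst z) (snd z))\<^sup>2"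
      by eventually_elim blast
    then have "(\<integral>z. \<phi> (fst z) + \<psi> (snd z) \<partial>\<pi>) \<le> (\<integral>z. a * (edist d (fst z) (snd z))\<^sup>2 \<partial>\<pi>)"
      using ci int by (intro integral_mono_AE) auto
    then show ?thesis using ci int by simp
  qed
  show ?thesis
  proof (cases "a = 0")
    \<comment> \<open>Dividing by a is impossible here, but the bound from any single coupling
      already has right-hand side 0.\<close>
    case True
    then show ?thesis using bound ne by auto
  next
    case False
    then have "?r / a \<le> (INF \<pi>\<in>couplings d P Q. ?I \<pi>)"
      using a bound by (intro cINF_greatest[OF ne]) (simp add: divide_le_eq mult.commute)
    then show ?thesis using False a by (simp add: W2_squared[OF PQ] divide_le_eq mult.commute)
  qed
qed

text \<open>The potentials on the side of the barycenter are the conjugates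
  \<open>w \<mapsto> min\<^sub>j (c \<lambda>\<^sub>i \<parallel>x\<^sub>i\<^sub>j - w\<parallel>\<^sup>2 - \<gamma>\<^sub>i\<^sub>j)\<close>. Their sum over i is nonnegative: feasibility
  of \<open>\<gamma>\<close> is applied to the tuple of minimising indices.\<close>

lemma dual_feasible_le_barycenter_objective:
  assumes P: "P \<in> P2 d" and m: "\<And>i. i \<in> {1..k} \<Longrightarrow> 1 \<le> m i"
    and lam: "\<And>i. i \<in> {1..k} \<Longrightarrow> 0 \<le> lam i" and c: "0 \<le> c"
    and x: "\<And>i j. i \<in> {1..k} \<Longrightarrow> j \<in> {1..m i} \<Longrightarrow> x i j \<in> topspace (Euclidean_space d)"
    and inj: "\<And>i. i \<in> {1..k} \<Longrightarrow> inj_on (x i) {1..m i}"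
    and p: "\<And>i j. i \<in> {1..k} \<Longrightarrow> j \<in> {1..m i} \<Longrightarrow> 0 \<le> p i j"
    and p1: "\<And>i. i \<in> {1..k} \<Longrightarrow> (\<Sum>j\<in>{1..m i}. p i j) = 1"
    and cost: "\<And>j w. j \<in> (\<Pi>\<^sub>E i\<in>{1..k}. {1..m i}) \<Longrightarrow> w \<in> topspace (Euclidean_space d) \<Longrightarrow>
      tuple_cost d k lam x S j \<le> c * (\<Sum>i\<in>{1..k}. lam i * (edist d (x i (j i)) w)\<^sup>2)"
    and \<gamma>: "\<gamma> \<in> dual_feasible d k lam m x S"
  shows "(\<Sum>i\<in>{1..k}. \<Sum>j\<in>{1..m i}. p i j * \<gamma> i j)
    \<le> c * (\<Sum>i\<in>{1..k}. lam i * (W2 d P (discrete_measure d (m i) (p i) (x i)))\<^sup>2)"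
proof -
  interpret prob_space P using P by (simp add: P2_def)
  define h where "h i w j = c * lam i * (edist d w (x i j))\<^sup>2 - \<gamma> i j" for i w j
  define \<phi> where "\<phi> i w = Min ((\<lambda>j. h i w j) ` {1..m i})" for i w
  \<comment> \<open>The dual variables are extended by zero off the support; the potential
    inequality may fail there, but that set is null for the discrete measure.\<close>
  define g where "g i y = (\<Sum>j\<in>{1..m i}. \<gamma> i j * indicator {x i j} y :: real)" for i y
  have \<phi>_le: "\<phi> i w \<le> h i w j" if "j \<in> {1..m i}" for i w j
    unfolding \<phi>_def using that by (intro Min_le) auto
  have \<phi>_ex: "\<exists>j\<in>{1..m i}. \<phi> i w = h i w j" if "i \<in> {1..k}" for i w
  proof -
    have "\<phi> i w \<in> (\<lambda>j. h i w j) ` {1..m i}"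
      unfolding \<phi>_def using m[OF that] by (intro Min_in) auto
    then show ?thesis by blast
  qed
  have int_h: "integrable P (\<lambda>w. h i w j)" if "i \<in> {1..k}" "j \<in> {1..m i}" for i j
    unfolding h_def using P2_integrable_edist_squared[OF P x[OF that]] by simp
  have int_\<phi>: "integrable P (\<phi> i)" if i: "i \<in> {1..k}" for i
  proof (rule Bochner_Integration.integrable_bound)
    show "integrable P (\<lambda>w. \<Sum>j\<in>{1..m i}. \<bar>h i w j\<bar>)"
      using int_h[OF i] by (intro Bochner_Integration.integrable_sum integrable_abs)
    show "\<phi> i \<in> borel_measurable P"
      unfolding \<phi>_def using int_h[OF i] by (intro borel_measurable_Min) auto
    \<comment> \<open>The minimum is attained by one of the \<open>h i w j\<close>, so the sum of
      all their absolute values dominates it.\<close>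
    have "\<bar>\<phi> i w\<bar> \<le> (\<Sum>j\<in>{1..m i}. \<bar>h i w j\<bar>)" for w
    proof -
      obtain j where "j \<in> {1..m i}" "\<phi> i w = h i w j" using \<phi>_ex[OF i] by blast
      then show ?thesis by (auto intro: member_le_sum[of j _ "\<lambda>j. \<bar>h i w j\<bar>"])
    qed
    then show "AE w in P. norm (\<phi> i w) \<le> norm (\<Sum>j\<in>{1..m i}. \<bar>h i w j\<bar>)"
      by (intro AE_I2) (simp add: order_trans[OF _ abs_ge_self])
  qed
  have pointwise: "0 \<le> (\<Sum>i\<in>{1..k}. \<phi> i w)" if w: "w \<in> topspace (Euclidean_space d)" for w
  proof -
    have "\<forall>i\<in>{1..k}. \<exists>j. j \<in> {1..m i} \<and> \<phi> i w = h i w j" using \<phi>_ex by blast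
    from bchoice[OF this] obtain s0 where
      s0: "\<And>i. i \<in> {1..k} \<Longrightarrow> s0 i \<in> {1..m i} \<and> \<phi> i w = h i w (s0 i)" by blast
    \<comment> \<open>Restriction makes the chosen indices a member of the extensional product over
      which feasibility is stated.\<close>
    define s where "s = restrict s0 {1..k}"
    have sJ: "s \<in> (\<Pi>\<^sub>E i\<in>{1..k}. {1..m i})" using s0 by (auto simp: s_def)
    have "(\<Sum>i\<in>{1..k}. \<phi> i w) = (\<Sum>i\<in>{1..k}. h i w (s i))"
      using s0 by (intro sum.cong) (auto simp: s_def)
    also have "\<dots> = c * (\<Sum>i\<in>{1..k}. lam i * (edist d (x i (s i)) w)\<^sup>2) - (\<Sum>i\<in>{1..k}. \<gamma> i (s i))"
      by (simp add: h_def sum_subtractf sum_distrib_left edist_commute[of d w] mult.assoc)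
    also have "\<dots> \<ge> tuple_cost d k lam x S s - (\<Sum>i\<in>{1..k}. \<gamma> i (s i))"
      using cost[OF sJ w] by simp
    moreover have "0 \<le> tuple_cost d k lam x S s - (\<Sum>i\<in>{1..k}. \<gamma> i (s i))"
      using \<gamma> sJ unfolding dual_feasible_def by blast
    ultimately show ?thesis by linarith
  qed
  let ?Q = "\<lambda>i. discrete_measure d (m i) (p i) (x i)"
  have W: "(\<integral>w. \<phi> i w \<partial>P) + (\<Sum>j\<in>{1..m i}. p i j * \<gamma> i j) \<le> c * lam i * (W2 d P (?Q i))\<^sup>2"
    if i: "i \<in> {1..k}" for i
  proof -
    have Q: "?Q i \<in> P2 d" using x p p1 i by (intro discrete_measure_in_P2) auto
    have gi: "integrable (?Q i) (g i)"
      unfolding g_def by (rule discrete_measure_indicator_sum(1)) (use i x inj p p1 in auto)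
    have int_g: "(\<integral>y. g i y \<partial>?Q i) = (\<Sum>j\<in>{1..m i}. p i j * \<gamma> i j)"
      unfolding g_def by (rule discrete_measure_indicator_sum(2)) (use i x inj p p1 in auto)
    have gx: "g i (x i j) = \<gamma> i j" if j: "j \<in> {1..m i}" for j
    proof -
      have "g i (x i j) = (\<Sum>l\<in>{1..m i}. if l = j then \<gamma> i l else 0)"
        unfolding g_def using inj[OF i] j by (intro sum.cong) (auto simp: inj_on_eq_iff indicator_def)
      then show ?thesis using j by simp
    qed
    have "AE y in ?Q i. y \<in> x i ` {1..m i}" using x[OF i] by (rule AE_discrete_measure)
    then have "AE y in ?Q i. \<forall>w\<in>topspace (Euclidean_space d). \<phi> i w + g i y \<le> c * lam i * (edist d w y)\<^sup>2"
    proof eventually_elim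
      case (elim y)
      then obtain j where j: "j \<in> {1..m i}" "y = x i j" by blast
      then show ?case using \<phi>_le[OF j(1)] gx[OF j(1)] by (auto simp: h_def le_diff_eq)
    qed
    then have "(\<integral>w. \<phi> i w \<partial>P) + (\<integral>y. g i y \<partial>?Q i) \<le> c * lam i * (W2 d P (?Q i))\<^sup>2"
      using c lam[OF i] gi int_\<phi>[OF i] by (intro integral_potentials_le_W2[OF P Q]) auto
    then show ?thesis using int_g by simp
  qed
  \<comment> \<open>Adding this nonnegative quantity to the dual objective can only increase it, and
    the result is then compared with the Wasserstein terms one i at a time.\<close>
  have "0 \<le> (\<integral>w. (\<Sum>i\<in>{1..k}. \<phi> i w) \<partial>P)"
    using pointwise P2_space[OF P] by (intro integral_nonneg_AE AE_I2) auto
  also have "\<dots> = (\<Sum>i\<in>{1..k}. \<integral>w. \<phi> i w \<partial>P)"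
    using int_\<phi> by (rule Bochner_Integration.integral_sum)
  finally have "(\<Sum>i\<in>{1..k}. \<Sum>j\<in>{1..m i}. p i j * \<gamma> i j)
      \<le> (\<Sum>i\<in>{1..k}. (\<integral>w. \<phi> i w \<partial>P) + (\<Sum>j\<in>{1..m i}. p i j * \<gamma> i j))"
    by (simp add: sum.distrib)
  also have "\<dots> \<le> (\<Sum>i\<in>{1..k}. c * lam i * (W2 d P (?Q i))\<^sup>2)"
    by (intro sum_mono W)
  finally show ?thesis by (simp add: sum_distrib_left mult.assoc)
qed

section \<open>The candidate support\<close>

text \<open>A candidate point is determined by T and a choice of one point from each support indexed
  by T. There are at most k^t sets T and n^t choices for each; different choices may give the same
  point, so this is only an upper bound.\<close>

lemma S2_finite_card_le:
  assumes \<Xi>: "\<And>i. i \<in> {1..k} \<Longrightarrow> finite (\<Xi> i) \<and> card (\<Xi> i) \<le> n"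
  shows "finite (S2 t k \<Xi>)" and "card (S2 t k \<Xi>) \<le> (n * k) ^ t"
proof -
  let ?F = "{T. T \<subseteq> {1..k} \<and> card T = t}"
  let ?D = "Sigma ?F (\<lambda>T. Pi\<^sub>E T \<Xi>)"
  let ?f = "\<lambda>(T, y) c. (1 / real t) * (\<Sum>i\<in>T. y i c)"
  have fin: "finite T" if "T \<in> ?F" for T using that finite_subset[of T "{1..k}"] by simp
  have finF: "finite ?F" by simp
  have finPi: "finite (Pi\<^sub>E T \<Xi>)" if T: "T \<in> ?F" for T
    by (rule finite_PiE[OF fin[OF T]]) (use \<Xi> T in blast)
  have finD: "finite ?D" using finF finPi by (rule finite_SigmaI)
  have sub: "S2 t k \<Xi> \<subseteq> ?f ` ?D"
  proof
    fix s assume "s \<in> S2 t k \<Xi>"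
    then obtain T y where s: "s = (\<lambda>c. (1 / real t) * (\<Sum>i\<in>T. y i c))"
      and T: "T \<in> ?F" and y: "\<forall>i\<in>T. y i \<in> \<Xi> i"
      unfolding S2_def by blast
    \<comment> \<open>Values of y outside T do not affect the mean; fixing them by restriction
      leaves only finitely many choice functions.\<close>
    have "s = ?f (T, restrict y T)" by (simp add: s cong: sum.cong)
    moreover have "(T, restrict y T) \<in> ?D" using T y by auto
    ultimately show "s \<in> ?f ` ?D" by (rule image_eqI)
  qed
  then show "finite (S2 t k \<Xi>)" using finD by (meson finite_imageI finite_subset)
  have PiE: "card (Pi\<^sub>E T \<Xi>) \<le> n ^ t" if T: "T \<in> ?F" for T
  proof -
    have "card (Pi\<^sub>E T \<Xi>) = (\<Prod>i\<in>T. card (\<Xi> i))" using fin[OF T] by (rule card_PiE)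
    also have "\<dots> \<le> (\<Prod>i\<in>T. n)" using \<Xi> T by (intro prod_mono) auto
    finally show ?thesis using T by simp
  qed
  have "card (S2 t k \<Xi>) \<le> card ?D"
    using sub finD by (meson card_image_le card_mono finite_imageI order_trans)
  also have "\<dots> = (\<Sum>T\<in>?F. card (Pi\<^sub>E T \<Xi>))"
    using finF finPi by (intro card_SigmaI ballI)
  also have "\<dots> \<le> (\<Sum>T\<in>?F. n ^ t)" by (intro sum_mono PiE)
  also have "\<dots> = (k choose t) * n ^ t" using n_subsets[of "{1..k}" t] by simp
  also have "k choose t \<le> k ^ t"
  proof (cases "t \<le> k")
    case True then show ?thesis by (rule binomial_le_pow)
  qed (simp add: binomial_eq_0)
  finally show "card (S2 t k \<Xi>) \<le> (n * k) ^ t" by (simp add: power_mult_distrib mult.commute)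
qed

text \<open>The subset mean found by averaging is itself a candidate, so the minimum is at most its
  cost. Equal weights let 1/k factor out of both sides, which reduces the claim to the unweighted
  estimate.\<close>

lemma tuple_cost_S2_le:
  assumes k: "2 \<le> k" and t: "t \<in> {1..k}" and fin: "finite (S2 t k \<Xi>)"
    and x: "\<And>i. i \<in> {1..k} \<Longrightarrow> x i (j i) \<in> \<Xi> i"
  shows "tuple_cost d k (\<lambda>_. 1 / real k) x (S2 t k \<Xi>) j
    \<le> (1 + (real k - real t) / (real t * (real k - 1))) *
       (\<Sum>i\<in>{1..k}. (1 / real k) * (edist d (x i (j i)) w)\<^sup>2)"
proof -
  let ?c = "1 + (real k - real t) / (real t * (real k - 1))"
  obtain T where T: "T \<subseteq> {1..k}" "card T = t"
    and le: "(\<Sum>i\<in>{1..k}. (edist d (x i (j i)) (\<lambda>c. (1 / real t) * (\<Sum>l\<in>T. x l (j l) c)))\<^sup>2)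
      \<le> ?c * (\<Sum>i\<in>{1..k}. (edist d (x i (j i)) w)\<^sup>2)"
    using ex_subset_mean_cost_le[of "{1..k}" t d "\<lambda>i. x i (j i)" w] k t by auto
  define s where "s = (\<lambda>c. (1 / real t) * (\<Sum>l\<in>T. x l (j l) c))"
  have "s \<in> S2 t k \<Xi>"
    unfolding S2_def s_def using T x by (intro CollectI exI[of _ T] exI[of _ "\<lambda>l. x l (j l)"]) auto
  then have "tuple_cost d k (\<lambda>_. 1 / real k) x (S2 t k \<Xi>) j
      \<le> (\<Sum>i\<in>{1..k}. (1 / real k) * (edist d (x i (j i)) s)\<^sup>2)"
    unfolding tuple_cost_def using fin by (intro Min_le) auto
  also have "\<dots> = (1 / real k) * (\<Sum>i\<in>{1..k}. (edist d (x i (j i)) s)\<^sup>2)"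
    by (simp only: sum_distrib_left)
  also have "\<dots> \<le> (1 / real k) * (?c * (\<Sum>i\<in>{1..k}. (edist d (x i (j i)) w)\<^sup>2))"
    using le unfolding s_def by (intro mult_left_mono) auto
  also have "\<dots> = ?c * (\<Sum>i\<in>{1..k}. (1 / real k) * (edist d (x i (j i)) w)\<^sup>2)"
    by (simp only: sum_distrib_left mult.left_commute)
  finally show ?thesis .
qed

lemma S2_nonempty:
  assumes t: "t \<le> k" and \<Xi>: "\<And>i. i \<in> {1..k} \<Longrightarrow> \<Xi> i \<noteq> {}"
  shows "S2 t k \<Xi> \<noteq> {}"
proof -
  have "\<forall>i\<in>{1..t}. (SOME y. y \<in> \<Xi> i) \<in> \<Xi> i" using t \<Xi> by (auto simp: some_in_eq)
  then have "(\<lambda>c. (1 / real t) * (\<Sum>i\<in>{1..t}. (SOME y. y \<in> \<Xi> i) c)) \<in> S2 t k \<Xi>"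
    unfolding S2_def using t by (intro CollectI exI[of _ "{1..t}"] exI[of _ "\<lambda>i. SOME y. y \<in> \<Xi> i"]) auto
  then show ?thesis by blast
qed

text \<open>An optimal dual solution is tested against every P in \<open>P2 d\<close>; dividing by
  the constant, which is at least 1, gives a lower bound that passes to the infimum over P.\<close>

lemma dual_value_S2_le:
  assumes k: "2 \<le> k" and t: "t \<in> {1..k}"
    and \<Xi>: "\<And>i. i \<in> {1..k} \<Longrightarrow> finite (\<Xi> i) \<and> \<Xi> i \<noteq> {} \<and> \<Xi> i \<subseteq> topspace (Euclidean_space d)"
    and x: "\<And>i. i \<in> {1..k} \<Longrightarrow> bij_betw (x i) {1..card (\<Xi> i)} (\<Xi> i)"
    and p: "\<And>i j. i \<in> {1..k} \<Longrightarrow> j \<in> {1..card (\<Xi> i)} \<Longrightarrow> 0 \<le> p i j"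
    and p1: "\<And>i. i \<in> {1..k} \<Longrightarrow> (\<Sum>j\<in>{1..card (\<Xi> i)}. p i j) = 1"
  shows "dual_value d k (\<lambda>_. 1 / real k) (\<lambda>i. card (\<Xi> i)) p x (S2 t k \<Xi>)
    \<le> (1 + (real k - real t) / (real t * (real k - 1))) *
       barycenter_value d k (\<lambda>_. 1 / real k) (\<lambda>i. discrete_measure d (card (\<Xi> i)) (p i) (x i))"
proof -
  let ?c = "1 + (real k - real t) / (real t * (real k - 1))"
  let ?lam = "\<lambda>_::nat. 1 / real k"
  let ?m = "\<lambda>i. card (\<Xi> i)"
  let ?S = "S2 t k \<Xi>"
  let ?Q = "\<lambda>i. discrete_measure d (?m i) (p i) (x i)"
  let ?v = "dual_value d k ?lam ?m p x ?S"
  have c: "1 \<le> ?c" using k t by auto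
  have m: "1 \<le> ?m i" if "i \<in> {1..k}" for i
    using \<Xi>[OF that] by (simp add: Suc_le_eq card_gt_0_iff)
  have xin: "x i j \<in> \<Xi> i" if "i \<in> {1..k}" "j \<in> {1..?m i}" for i j
    using x[OF that(1)] that(2) by (rule bij_betwE[THEN bspec])
  have xtop: "x i j \<in> topspace (Euclidean_space d)" if "i \<in> {1..k}" "j \<in> {1..?m i}" for i j
    using xin[OF that] \<Xi>[OF that(1)] by blast
  have inj: "inj_on (x i) {1..?m i}" if "i \<in> {1..k}" for i
    using x[OF that] by (rule bij_betw_imp_inj_on)
  \<comment> \<open>Only finiteness is wanted, so any common bound on the support sizes will do, for
    instance their maximum.\<close>
  have finS: "finite ?S"
    using \<Xi> by (intro S2_finite_card_le[where n = "Max (?m ` {1..k})"]) auto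
  have neS: "?S \<noteq> {}" using t \<Xi> by (intro S2_nonempty) auto
  obtain \<gamma> where \<gamma>: "\<gamma> \<in> dual_feasible d k ?lam ?m x ?S"
    and v: "(\<Sum>i\<in>{1..k}. \<Sum>j\<in>{1..?m i}. p i j * \<gamma> i j) = ?v"
    using dual_value_attained[where d = d and k = k and m = ?m and p = p and x = x and lam = ?lam and S = ?S]
      k m p p1 finS neS by auto
  have cost: "tuple_cost d k ?lam x ?S j \<le> ?c * (\<Sum>i\<in>{1..k}. ?lam i * (edist d (x i (j i)) w)\<^sup>2)"
    if "j \<in> (\<Pi>\<^sub>E i\<in>{1..k}. {1..?m i})" for j w
    using that xin by (intro tuple_cost_S2_le[OF k t finS]) (auto simp: PiE_iff)
  have bound: "?v / ?c \<le> (\<Sum>i\<in>{1..k}. ?lam i * (W2 d P (?Q i))\<^sup>2)" if "P \<in> P2 d" for P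
  proof -
    have "?v \<le> ?c * (\<Sum>i\<in>{1..k}. ?lam i * (W2 d P (?Q i))\<^sup>2)"
      unfolding v[symmetric]
      by (rule dual_feasible_le_barycenter_objective[OF that m _ _ xtop inj p p1 cost \<gamma>])
        (use c in auto)
    then show ?thesis using c by (simp add: divide_le_eq mult.commute)
  qed
  \<comment> \<open>The infimum needs a nonempty range; the first input measure is a
    witness.\<close>
  have "?Q 1 \<in> P2 d"
    using k xtop p p1 by (intro discrete_measure_in_P2) auto
  then have "?v / ?c \<le> barycenter_value d k ?lam ?Q"
    unfolding barycenter_value_def using bound by (intro cINF_greatest) auto
  then show ?thesis using c by (simp add: divide_le_eq mult.commute)
qed

theorem theorem5:
  fixes t :: nat
  shows "\<exists>C>0::real.
    \<forall>(d::nat) (k::nat) (n::nat) (\<Xi> :: nat \<Rightarrow> (nat \<Rightarrow> real) set)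
      (xhat :: nat \<Rightarrow> nat \<Rightarrow> nat \<Rightarrow> real) (phat :: nat \<Rightarrow> nat \<Rightarrow> real).
      2 \<le> k \<longrightarrow> t \<in> {1..k} \<longrightarrow>
      (\<forall>i\<in>{1..k}.
         finite (\<Xi> i) \<and> \<Xi> i \<noteq> {} \<and> \<Xi> i \<subseteq> topspace (Euclidean_space d) \<and> card (\<Xi> i) \<le> n \<and>
         bij_betw (xhat i) {1..card (\<Xi> i)} (\<Xi> i) \<and>
         (\<forall>j\<in>{1..card (\<Xi> i)}. 0 \<le> phat i j) \<and> (\<Sum>j\<in>{1..card (\<Xi> i)}. phat i j) = 1) \<longrightarrow>
      dual_value d k (\<lambda>_. 1 / real k) (\<lambda>i. card (\<Xi> i)) phat xhat (S2 t k \<Xi>)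
        \<le> (1 + (real k - real t) / (real t * (real k - 1))) *
          barycenter_value d k (\<lambda>_. 1 / real k)
            (\<lambda>i. discrete_measure d (card (\<Xi> i)) (phat i) (xhat i)) \<and>
      finite (S2 t k \<Xi>) \<and> real (card (S2 t k \<Xi>)) \<le> C * (real n * real k) ^ t"
\<comment> \<open>The cardinality estimate (n k)^t carries no extra factor, so C = 1 serves for
  every t.\<close>
proof (rule exI[of _ 1], intro conjI allI impI)
  fix d k n :: nat and \<Xi> :: "nat \<Rightarrow> (nat \<Rightarrow> real) set"
    and xhat :: "nat \<Rightarrow> nat \<Rightarrow> nat \<Rightarrow> real" and phat :: "nat \<Rightarrow> nat \<Rightarrow> real"
  assume k: "2 \<le> k" and t: "t \<in> {1..k}"
    and \<Xi>: "\<forall>i\<in>{1..k}.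
         finite (\<Xi> i) \<and> \<Xi> i \<noteq> {} \<and> \<Xi> i \<subseteq> topspace (Euclidean_space d) \<and> card (\<Xi> i) \<le> n \<and>
         bij_betw (xhat i) {1..card (\<Xi> i)} (\<Xi> i) \<and>
         (\<forall>j\<in>{1..card (\<Xi> i)}. 0 \<le> phat i j) \<and> (\<Sum>j\<in>{1..card (\<Xi> i)}. phat i j) = 1"
  show "dual_value d k (\<lambda>_. 1 / real k) (\<lambda>i. card (\<Xi> i)) phat xhat (S2 t k \<Xi>)
        \<le> (1 + (real k - real t) / (real t * (real k - 1))) *
          barycenter_value d k (\<lambda>_. 1 / real k)
            (\<lambda>i. discrete_measure d (card (\<Xi> i)) (phat i) (xhat i))"
    using \<Xi> by (intro dual_value_S2_le[OF k t]) blast+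
  show "finite (S2 t k \<Xi>)"
    using \<Xi> by (intro S2_finite_card_le[where n = n]) blast
  have "card (S2 t k \<Xi>) \<le> (n * k) ^ t"
    using \<Xi> by (intro S2_finite_card_le) blast
  then show "real (card (S2 t k \<Xi>)) \<le> 1 * (real n * real k) ^ t"
    by (metis mult_1 of_nat_le_iff of_nat_mult of_nat_power)
qed simp

end
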